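(* Let $\mathbb{F}=(W,\{\nu_n\}_{n\in\mathbb{N}})$ be a neighbourhood frame. Then $\mathbb{F}$ is a graded neighbourhood frame if and only if for all $w\in W$ the following conditions hold: (1) $\nu_0(w)=\mathcal{P}(W)$; (2) for all $n\in\mathbb{N}$, $\nu_n(w)$ is closed under supersets (in $W$); (3) $\emptyset\notin\nu_n(w)$ for all $n\in\mathbb{N}$ with $n\ge 1$; (4) for all $n\in\mathbb{N}$, if $X\in\nu_n(w)$, then there exists a minimal element $Y$ of $\nu_n(w)$ with $Y\subseteq X$; (5) for all $n\in\mathbb{N}$, if $Y$ is a minimal element of $\nu_n(w)$, then $|Y|=n$ and $Y$ is atomic in $\nu_1(w)$; (6) for all $n\in\mathbb{N}$, if $\{y_1\},\ldots,\{y_n\}\in\nu_1(w)$ and $y_1,\ldots,y_n$ are pairwise distinct, then $\bigcup_{1\le i\le n}\{y_i\}$ is a minimal element of $\nu_n(w)$.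
   Context: $\mathbb{N}$ includes $0$. A neighbourhood frame is a tuple $(W,\{\nu_n\}_{n\in\mathbb{N}})$ with $W$ a set and $\nu_n:W\to\mathcal{P}(\mathcal{P}(W))$ for each $n$. For a set $X$, $\mathcal{P}_{\ge n}(X)=\{X'\subseteq X:|X'|\ge n\}$. For $\Gamma\subseteq\mathcal{P}(W)$, $\uparrow\Gamma=\{Y\in\mathcal{P}(W):\exists X\in\Gamma,\ X\subseteq Y\}$. A neighbourhood frame $(W,\{\nu_n\}_{n\in\mathbb{N}})$ is a graded neighbourhood frame if for all $w\in W$ there exists $A\subseteq W$ such that for all $n\in\mathbb{N}$, $\nu_n(w)=\uparrow\mathcal{P}_{\ge n}(A)$. A set $A\subseteq W$ is atomic in $\nu_1(w)$ if $\{a\}\in\nu_1(w)$ for all $a\in A$. "Minimal" is with respect to inclusion. *)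

theory Defs
  imports Main "HOL-Library.FuncSet"
begin

definition neighbourhood_frame :: "'a set \<Rightarrow> (nat \<Rightarrow> 'a \<Rightarrow> 'a set set) \<Rightarrow> bool" where
  "neighbourhood_frame W \<nu> \<longleftrightarrow> (\<forall>n. \<nu> n \<in> W \<rightarrow> Pow (Pow W))"

text \<open>
  An infinite set has at least \<open>n\<close> elements for every \<open>n\<close>; since \<^const>\<open>card\<close> is \<open>0\<close> on
  infinite sets, this case is stated separately.
\<close>

definition subsets_at_least :: "nat \<Rightarrow> 'a set \<Rightarrow> 'a set set" where
  "subsets_at_least n X = {X'. X' \<subseteq> X \<and> (infinite X' \<or> n \<le> card X')}"

definition up_closure :: "'a set \<Rightarrow> 'a set set \<Rightarrow> 'a set set" where
  "up_closure W \<Gamma> = {Y \<in> Pow W. \<exists>X\<in>\<Gamma>. X \<subseteq> Y}"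

definition graded_neighbourhood_frame :: "'a set \<Rightarrow> (nat \<Rightarrow> 'a \<Rightarrow> 'a set set) \<Rightarrow> bool" where
  "graded_neighbourhood_frame W \<nu> \<longleftrightarrow>
    neighbourhood_frame W \<nu> \<and>
    (\<forall>w\<in>W. \<exists>A\<subseteq>W. \<forall>n. \<nu> n w = up_closure W (subsets_at_least n A))"

definition closed_under_supersets :: "'a set \<Rightarrow> 'a set set \<Rightarrow> bool" where
  "closed_under_supersets W \<Gamma> \<longleftrightarrow> (\<forall>X\<in>\<Gamma>. \<forall>Y. X \<subseteq> Y \<and> Y \<subseteq> W \<longrightarrow> Y \<in> \<Gamma>)"

definition minimal_in :: "'a set \<Rightarrow> 'a set set \<Rightarrow> bool" where
  "minimal_in Y \<Gamma> \<longleftrightarrow> Y \<in> \<Gamma> \<and> (\<forall>Z\<in>\<Gamma>. \<not> Z \<subset> Y)"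

definition atomic_in :: "'a set \<Rightarrow> 'a set set \<Rightarrow> bool" where
  "atomic_in A \<Gamma> \<longleftrightarrow> (\<forall>a\<in>A. {a} \<in> \<Gamma>)"

end

theory Submission
  imports Defs
begin

text \<open>
  The upward closure of the subsets of \<open>A\<close> with at least \<open>n\<close> elements is already generated by the
  subsets with exactly \<open>n\<close> elements, and these are its minimal elements. Hence the set \<open>A\<close> can be
  recovered from the neighbourhoods of \<open>w\<close> as the set of all \<open>a\<close> with \<open>{a} \<in> \<nu> 1 w\<close>.
\<close>

lemma up_closure_subsets_at_least:
  "up_closure W (subsets_at_least n A) =
    {Y. Y \<subseteq> W \<and> (\<exists>Z\<subseteq>Y. Z \<subseteq> A \<and> finite Z \<and> card Z = n)}"
proof -
  have "(\<exists>X\<in>subsets_at_least n A. X \<subseteq> Y) \<longleftrightarrow> (\<exists>Z\<subseteq>Y. Z \<subseteq> A \<and> finite Z \<and> card Z = n)" for Y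
  proof
    assume "\<exists>X\<in>subsets_at_least n A. X \<subseteq> Y"
    then obtain X where X: "X \<subseteq> A" "infinite X \<or> n \<le> card X" "X \<subseteq> Y"
      by (auto simp: subsets_at_least_def)
    \<comment> \<open>Cut \<open>X\<close> down to exactly \<open>n\<close> elements; an infinite
      \<open>X\<close> has finite subsets of every size.\<close>
    obtain Z where "Z \<subseteq> X" "finite Z" "card Z = n"
    proof (cases "finite X")
      case True
      with X(2) show ?thesis using that by (metis obtain_subset_with_card_n)
    next
      case False
      then show ?thesis using that infinite_arbitrarily_large by blast
    qed
    with X show "\<exists>Z\<subseteq>Y. Z \<subseteq> A \<and> finite Z \<and> card Z = n"
      by blast
  qed (auto simp: subsets_at_least_def)
  then show ?thesis
    by (auto simp: up_closure_def)
qed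

text \<open>Each member lies above an \<open>n\<close>-element subset of \<open>A\<close>, which is
  itself a member because \<open>A \<subseteq> W\<close>; a minimal member must therefore equal
  it.\<close>

lemma minimal_in_up_closure_subsets_at_least:
  assumes "A \<subseteq> W"
  shows "minimal_in Y (up_closure W (subsets_at_least n A)) \<longleftrightarrow>
    Y \<subseteq> A \<and> finite Y \<and> card Y = n"
    (is "?min \<longleftrightarrow> ?card")
proof
  assume min: ?min
  then obtain Z where Z: "Z \<subseteq> Y" "Z \<subseteq> A" "finite Z" "card Z = n"
    by (auto simp: minimal_in_def up_closure_subsets_at_least)
  then have "Z \<in> up_closure W (subsets_at_least n A)"
    using assms by (auto simp: up_closure_subsets_at_least)
  with min Z(1) have "Z = Y"
    by (auto simp: minimal_in_def)
  with Z show ?card by simp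
next
  assume card: ?card
  \<comment> \<open>Otherwise \<open>Z\<close> would be a proper subset of the finite set
    \<open>Y\<close> with the same number of elements.\<close>
  have "\<not> X \<subset> Y" if "Z \<subseteq> X" "card Z = n" for X Z
    using that card by (metis psubset_card_mono subset_psubset_trans less_irrefl)
  with card assms show ?min
    by (auto simp: minimal_in_def up_closure_subsets_at_least)
qed

text \<open>Bridges the indexed families of condition (6) and the cardinality form used above. For
  \<open>n = 0\<close> the index set is empty and both sides say that \<open>Z\<close> is
  empty.\<close>

lemma ex_image_enumeration_iff:
  "(\<exists>y :: nat \<Rightarrow> 'a. (\<forall>i\<in>{1..n}. y i \<in> A) \<and> inj_on y {1..n} \<and> Z = (\<Union>i\<in>{1..n}. {y i})) \<longleftrightarrow>
    Z \<subseteq> A \<and> finite Z \<and> card Z = n"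
proof
  assume Z: "Z \<subseteq> A \<and> finite Z \<and> card Z = n"
  then obtain y where "bij_betw y {1..n} Z"
    using ex_bij_betw_nat_finite_1 by blast
  then have "inj_on y {1..n}" "y ` {1..n} = Z"
    by (auto simp: bij_betw_def)
  with Z show "\<exists>y. (\<forall>i\<in>{1..n}. y i \<in> A) \<and> inj_on y {1..n} \<and> Z = (\<Union>i\<in>{1..n}. {y i})"
    by (intro exI[of _ y]) auto
qed (auto simp: UNION_singleton_eq_range card_image)

theorem proposition5p1:
  fixes W :: "'a set" and \<nu> :: "nat \<Rightarrow> 'a \<Rightarrow> 'a set set"
  assumes "neighbourhood_frame W \<nu>"
  shows "graded_neighbourhood_frame W \<nu> \<longleftrightarrow>
    (\<forall>w\<in>W.
      \<nu> 0 w = Pow W \<and>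
      (\<forall>n. closed_under_supersets W (\<nu> n w)) \<and>
      (\<forall>n\<ge>1. {} \<notin> \<nu> n w) \<and>
      (\<forall>n. \<forall>X\<in>\<nu> n w. \<exists>Y. minimal_in Y (\<nu> n w) \<and> Y \<subseteq> X) \<and>
      (\<forall>n Y. minimal_in Y (\<nu> n w) \<longrightarrow> finite Y \<and> card Y = n \<and> atomic_in Y (\<nu> 1 w)) \<and>
      (\<forall>n. \<forall>y :: nat \<Rightarrow> 'a.
        (\<forall>i\<in>{1..n}. {y i} \<in> \<nu> 1 w) \<and> inj_on y {1..n} \<longrightarrow>
          minimal_in (\<Union>i\<in>{1..n}. {y i}) (\<nu> n w)))"
    (is "_ \<longleftrightarrow> ?conditions" is "_ \<longleftrightarrow> (\<forall>w\<in>W. ?conditions_at w)")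
proof
  assume "graded_neighbourhood_frame W \<nu>"
  then have graded: "\<exists>A\<subseteq>W. \<forall>n. \<nu> n w = up_closure W (subsets_at_least n A)" if "w \<in> W" for w
    using that by (auto simp: graded_neighbourhood_frame_def)
  show ?conditions
  proof
    fix w assume "w \<in> W"
    with graded obtain A where A: "A \<subseteq> W" "\<And>n. \<nu> n w = up_closure W (subsets_at_least n A)"
      by blast
    note mem = A(2)[unfolded up_closure_subsets_at_least]
    have min: "minimal_in Y (\<nu> n w) \<longleftrightarrow> Y \<subseteq> A \<and> finite Y \<and> card Y = n" for n Y
      using minimal_in_up_closure_subsets_at_least[OF A(1)] A(2) by simp
    \<comment> \<open>The case \<open>n = 1\<close> recovers \<open>A\<close> from
      \<open>\<nu> 1 w\<close>, which turns atomicity into inclusion in \<open>A\<close>.\<close>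
    have single: "{a} \<in> \<nu> 1 w \<longleftrightarrow> a \<in> A" for a
    proof
      assume "{a} \<in> \<nu> 1 w"
      then obtain Z where "Z \<subseteq> {a}" "Z \<subseteq> A" "card Z = 1"
        by (auto simp: mem)
      then show "a \<in> A" by (auto simp: subset_singleton_iff)
    next
      assume "a \<in> A"
      then have "minimal_in {a} (\<nu> 1 w)" by (simp add: min)
      then show "{a} \<in> \<nu> 1 w" by (simp add: minimal_in_def)
    qed
    show "?conditions_at w"
    proof (intro conjI allI ballI impI)
      show "\<nu> 0 w = Pow W"
        \<comment> \<open>The empty set is a subset of \<open>A\<close> with \<open>0\<close>
          elements and lies below every subset of \<open>W\<close>.\<close>
        by (auto simp: mem intro!: exI[of _ "{}"])
      show "closed_under_supersets W (\<nu> n w)" for n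
        unfolding closed_under_supersets_def A(2) up_closure_def by blast
      show "{} \<notin> \<nu> n w" if "n \<ge> 1" for n
        using that by (auto simp: mem)
      show "\<exists>Y. minimal_in Y (\<nu> n w) \<and> Y \<subseteq> X" if "X \<in> \<nu> n w" for n X
        using that unfolding min by (auto simp: mem)
      show "finite Y" "card Y = n" "atomic_in Y (\<nu> 1 w)" if "minimal_in Y (\<nu> n w)" for n Y
        using that unfolding min atomic_in_def single by blast+
      show "minimal_in (\<Union>i\<in>{1..n}. {y i}) (\<nu> n w)"
        if "(\<forall>i\<in>{1..n}. {y i} \<in> \<nu> 1 w) \<and> inj_on y {1..n}" for n and y :: "nat \<Rightarrow> 'a"
        using that unfolding min single ex_image_enumeration_iff[symmetric] by blast
    qed
  qed
next
  assume conditions: ?conditions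
  have "\<exists>A\<subseteq>W. \<forall>n. \<nu> n w = up_closure W (subsets_at_least n A)" if w: "w \<in> W" for w
  proof -
    \<comment> \<open>The only possible choice: \<open>single\<close> in the other direction shows
      that any generating set consists of exactly these points.\<close>
    define A where "A = {a. {a} \<in> \<nu> 1 w}"
    have sub: "\<nu> n w \<subseteq> Pow W" for n
      using assms w by (auto simp: neighbourhood_frame_def Pi_def)
    from conditions w have "?conditions_at w" ..
    then have up: "\<forall>n. closed_under_supersets W (\<nu> n w)"
      and min_below: "\<forall>n. \<forall>X\<in>\<nu> n w. \<exists>Y. minimal_in Y (\<nu> n w) \<and> Y \<subseteq> X"
      and min_card: "\<forall>n Y. minimal_in Y (\<nu> n w) \<longrightarrow>
        finite Y \<and> card Y = n \<and> atomic_in Y (\<nu> 1 w)"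
      and enum: "\<forall>n. \<forall>y :: nat \<Rightarrow> 'a. (\<forall>i\<in>{1..n}. y i \<in> A) \<and> inj_on y {1..n} \<longrightarrow>
        minimal_in (\<Union>i\<in>{1..n}. {y i}) (\<nu> n w)"
      unfolding A_def mem_Collect_eq by - (elim conjE, assumption)+
    \<comment> \<open>Condition (6) freed from enumerations: list the elements of \<open>Z\<close>
      as \<open>y 1\<close>, ..., \<open>y n\<close>.\<close>
    have min: "minimal_in Z (\<nu> n w)" if Z: "Z \<subseteq> A \<and> finite Z \<and> card Z = n" for n Z
    proof -
      from Z obtain y :: "nat \<Rightarrow> 'a"
        where "\<forall>i\<in>{1..n}. y i \<in> A" "inj_on y {1..n}" "Z = (\<Union>i\<in>{1..n}. {y i})"
        unfolding ex_image_enumeration_iff[symmetric] by blast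
      with enum show ?thesis by blast
    qed
    have "\<nu> n w = up_closure W (subsets_at_least n A)" for n
      unfolding up_closure_subsets_at_least
    proof (intro set_eqI iffI CollectI conjI)
      fix X assume X: "X \<in> \<nu> n w"
      then show "X \<subseteq> W" using sub by blast
      \<comment> \<open>Condition (4) supplies a minimal \<open>Y\<close> below \<open>X\<close>; by
        (5) it has \<open>n\<close> elements, and being atomic it lies in \<open>A\<close>.\<close>
      from X obtain Y where "minimal_in Y (\<nu> n w)" "Y \<subseteq> X"
        using min_below by blast
      with min_card show "\<exists>Z\<subseteq>X. Z \<subseteq> A \<and> finite Z \<and> card Z = n"
        unfolding A_def atomic_in_def by blast
    next
      fix X assume "X \<in> {Y. Y \<subseteq> W \<and> (\<exists>Z\<subseteq>Y. Z \<subseteq> A \<and> finite Z \<and> card Z = n)}"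
      \<comment> \<open>The \<open>n\<close>-element subset of \<open>A\<close> inside
        \<open>X\<close> is a minimal neighbourhood, so closure under supersets reaches
        \<open>X\<close>.\<close>
      then obtain Z where "X \<subseteq> W" "Z \<subseteq> X" "minimal_in Z (\<nu> n w)"
        using min by blast
      then show "X \<in> \<nu> n w"
        using up by (auto simp: minimal_in_def closed_under_supersets_def)
    qed
    moreover have "A \<subseteq> W"
      using sub by (auto simp: A_def)
    ultimately show ?thesis by blast
  qed
  with assms show "graded_neighbourhood_frame W \<nu>"
    by (simp add: graded_neighbourhood_frame_def)
qed

end
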